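(* Let $K$ be a compact set in the complex plane $\mathbb{C}$ such that $0$ belongs to the boundary $\partial K$, and let $m$ be a positive integer. Suppose there exist real numbers $\delta>0$ and $\alpha<\beta$ such that the sector $W=\{re^{i\theta} : 0\le r\le \delta,\ \alpha\le\theta\le\beta\}$ satisfies $W\cap K=\{0\}$. Then $\mathcal{A}(m,K)$ is dense in $\mathcal{A}(K)$ under the supremum norm on $K$; that is, for every $f\in\mathcal{A}(K)$ and every $\varepsilon>0$ there exists $g\in\mathcal{A}(m,K)$ with $\sup_{x\in K}|f(x)-g(x)|<\varepsilon$.
   Context: For a compact set $K\subset\mathbb{C}$ with $0\in\partial K$: $\mathcal{A}(K)$ denotes the space of all functions $f$ on $K$ such that $f$ is holomorphic in a neighborhood of $K$ (i.e. $f$ is the restriction to $K$ of a function holomorphic in some open set containing $K$) and $f(0)=0$. For a positive integer $m$, $\mathcal{A}(m,K)$ denotes the space of all $f$ such that $f$ is holomorphic in a neighborhood of $K$ and $f(0)=f'(0)=\cdots=f^{(m)}(0)=0$, where the derivatives are those of the holomorphic function on the neighborhood; elements of $\mathcal{A}(m,K)$ are regarded as functions on $K$ by restriction. *)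

theory Defs
  imports "HOL-Complex_Analysis.Complex_Analysis"
begin

text \<open>
  Elements are functions on \<open>K\<close> in the proper sense, i.e. restrictions to \<open>K\<close> (undefined elsewhere)
  of a function \<open>F\<close> holomorphic on some open set containing \<open>K\<close>.
\<close>

definition hol_vanishing :: "complex set \<Rightarrow> (complex \<Rightarrow> complex) set" where
  "hol_vanishing K =
     {restrict F K | F U. open U \<and> K \<subseteq> U \<and> F holomorphic_on U \<and> F 0 = 0}"

text \<open>
  The derivatives are those of the extension \<open>F\<close>: they need not be determined by the values on
  \<open>K\<close>, for instance if \<open>0\<close> is an isolated point of \<open>K\<close>.
\<close>

definition hol_vanishing_order :: "nat \<Rightarrow> complex set \<Rightarrow> (complex \<Rightarrow> complex) set" where
  "hol_vanishing_order m K =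
     {restrict F K | F U. open U \<and> K \<subseteq> U \<and> F holomorphic_on U \<and> (\<forall>j\<le>m. (deriv ^^ j) F 0 = 0)}"

definition sector :: "real \<Rightarrow> real \<Rightarrow> real \<Rightarrow> complex set" where
  "sector \<delta> \<alpha> \<beta> =
     {of_real r * exp (\<i> * of_real \<theta>) | r \<theta>. 0 \<le> r \<and> r \<le> \<delta> \<and> \<alpha> \<le> \<theta> \<and> \<theta> \<le> \<beta>}"

end

theory Submission
  imports Defs
begin

text \<open>
  Let \<open>u\<close> be the unit vector along the bisector of the sector. For small \<open>t > 0\<close> the function
  \<open>g z = f z * (z / (z - t * u)) ^ m\<close> is holomorphic near \<open>K\<close> and vanishes to order \<open>m\<close> at \<open>0\<close>.
  Off the sector, \<open>z / (z - t * u)\<close> is bounded independently of \<open>t\<close>, so \<open>f - g\<close> is small near \<open>0\<close>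
  because \<open>f\<close> is; away from \<open>0\<close> the factor tends uniformly to \<open>1\<close> as \<open>t\<close> tends to \<open>0\<close>.
\<close>

text \<open>Differentiating \<open>z ^ Suc m * h z\<close> leaves a product of the same shape with
  exponent \<open>m\<close>, whose cofactor again vanishes at 0, so induction on \<open>m\<close>
  applies. The zero of \<open>h\<close> supplies the one order beyond the \<open>m\<close> that come
  from the power.\<close>

lemma higher_deriv_power_mult_eq_0:
  fixes F h :: "complex \<Rightarrow> complex"
  assumes "open U" "0 \<in> U" "h holomorphic_on U" "h 0 = 0"
    and "\<And>z. z \<in> U \<Longrightarrow> F z = z ^ m * h z"
    and "j \<le> m"
  shows "(deriv ^^ j) F 0 = 0"
  using assms(3-6)
proof (induction m arbitrary: F h j)
  case 0
  then show ?case using \<open>0 \<in> U\<close> by simp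
next
  case (Suc m)
  show ?case
  proof (cases j)
    case 0
    then show ?thesis using Suc.prems \<open>0 \<in> U\<close> by simp
  next
    case (Suc i)
    \<comment> \<open>\<open>k\<close> is the cofactor left by the product rule once
      \<open>z ^ m\<close> is pulled out.\<close>
    define k where "k z = of_nat (Suc m) * h z + z * deriv h z" for z
    have "deriv F z = z ^ m * k z" if "z \<in> U" for z
    proof -
      have h: "(h has_field_derivative deriv h z) (at z)"
        using Suc.prems(1) \<open>open U\<close> that holomorphic_derivI by blast
      have "((\<lambda>z. z ^ Suc m * h z) has_field_derivative z ^ m * k z) (at z)"
        by (rule derivative_eq_intros h refl)+ (simp add: k_def algebra_simps)
      then have "(F has_field_derivative z ^ m * k z) (at z)"
        by (rule has_field_derivative_transform_within_open[OF _ \<open>open U\<close> that])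
           (simp add: Suc.prems(3))
      then show ?thesis by (rule DERIV_imp_deriv)
    qed
    moreover have "k holomorphic_on U"
      unfolding k_def using Suc.prems(1) \<open>open U\<close>
      by (intro holomorphic_intros holomorphic_deriv)
    moreover have "k 0 = 0" by (simp add: k_def Suc.prems(2))
    ultimately have "(deriv ^^ i) (deriv F) 0 = 0"
      using Suc.IH Suc.prems(4) Suc by auto
    then show ?thesis by (simp add: Suc funpow_Suc_right del: funpow.simps)
  qed
qed

text \<open>A point whose angle to the bisecting ray is at least \<eta> has distance at least
  \<open>sin \<eta> * cmod z\<close> from every point of that ray. The witness is therefore
  \<open>1 / sin \<eta>\<close>, which does not depend on \<open>t\<close>.\<close>

lemma norm_le_dist_bisector:
  fixes \<delta> \<alpha> \<beta> :: real
  assumes "\<alpha> < \<beta>"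
  obtains C where "C > 0"
    "\<And>z t. z \<notin> sector \<delta> \<alpha> \<beta> \<Longrightarrow> cmod z \<le> \<delta> \<Longrightarrow> 0 \<le> t \<Longrightarrow>
       cmod z \<le> C * cmod (z - of_real t * cis ((\<alpha> + \<beta>) / 2))"
proof
  define \<gamma> where "\<gamma> = (\<alpha> + \<beta>) / 2"
  \<comment> \<open>The cap \<open>pi / 4\<close> keeps \<eta> acute however wide the sector is; a
    narrower angle around the bisector still lies inside it.\<close>
  define \<eta> where "\<eta> = min ((\<beta> - \<alpha>) / 2) (pi / 4)"
  have \<eta>: "0 < \<eta>" "\<eta> < pi / 2" using assms pi_gt_zero unfolding \<eta>_def min_def by auto
  have s: "sin \<eta> > 0"
    using \<eta> pi_gt_zero by (intro sin_gt_zero) auto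
  show "1 / sin \<eta> > 0" using s by simp
  fix z :: complex and t :: real
  assume z: "z \<notin> sector \<delta> \<alpha> \<beta>" "cmod z \<le> \<delta>" and "0 \<le> t"
  \<comment> \<open>Rotating by the angle of the bisector moves that ray onto the positive real
    axis.\<close>
  define w where "w = z * cis (-\<gamma>)"
  have zw: "z = w * cis \<gamma>" by (simp add: w_def mult.assoc cis_mult)
  have norm_w: "cmod w = cmod z" by (simp add: w_def norm_mult)
  have Re_w: "Re w = cmod w * cos (Arg w)"
    using rcis_cmod_Arg[of w] by (metis Re_rcis)
  \<comment> \<open>Otherwise \<open>w\<close> would make an angle below \<eta> with the positive
    axis, and rotating back would put \<open>z\<close> in the sector.\<close>
  have "Re w \<le> cmod w * cos \<eta>"
  proof (rule ccontr)
    assume "\<not> ?thesis"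
    then have gt: "cmod w * cos \<eta> < cmod w * cos (Arg w)" using Re_w by simp
    have cos: "cos \<eta> < cos \<bar>Arg w\<bar>"
      using gt by (simp add: mult_less_cancel_left)
    have "\<bar>Arg w\<bar> \<le> pi" using Arg_bounded[of w] by auto
    then have "\<bar>Arg w\<bar> < \<eta>"
      using cos \<eta> cos_monotone_0_pi_le[of \<eta> "\<bar>Arg w\<bar>"] by linarith
    then have "\<alpha> \<le> \<gamma> + Arg w" "\<gamma> + Arg w \<le> \<beta>"
      by (auto simp: \<gamma>_def \<eta>_def field_simps)
    moreover have "z = of_real (cmod z) * exp (\<i> * of_real (\<gamma> + Arg w))"
    proof -
      have "z = rcis (cmod w) (Arg w) * cis \<gamma>" using zw by (simp add: rcis_cmod_Arg)
      also have "\<dots> = of_real (cmod w) * cis (\<gamma> + Arg w)"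
        by (simp add: rcis_def cis_mult mult.assoc add.commute)
      finally show ?thesis by (simp add: norm_w cis_conv_exp)
    qed
    ultimately show False using z unfolding sector_def by (auto intro: norm_ge_zero)
  qed
  \<comment> \<open>The right side is the law of cosines at angle \<eta>. As a quadratic in
    \<open>t\<close> it is smallest at \<open>t = cmod z * cos \<eta>\<close>, where it equals the
    left side.\<close>
  have "(sin \<eta> * cmod z)\<^sup>2 \<le> (cmod z)\<^sup>2 - 2 * t * (cmod w * cos \<eta>) + t\<^sup>2"
  proof -
    have "0 \<le> (t - cmod z * cos \<eta>)\<^sup>2" by simp
    moreover have "(sin \<eta> * cmod z)\<^sup>2 = (cmod z)\<^sup>2 - (cmod z * cos \<eta>)\<^sup>2"
      by (simp add: power_mult_distrib sin_squared_eq algebra_simps)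
    ultimately show ?thesis by (simp add: power2_diff norm_w algebra_simps)
  qed
  also have "\<dots> \<le> (cmod z)\<^sup>2 - 2 * t * Re w + t\<^sup>2"
    using \<open>Re w \<le> _\<close> \<open>0 \<le> t\<close> by (simp add: mult_left_mono)
  also have "\<dots> = (cmod (w - of_real t))\<^sup>2"
    unfolding norm_w[symmetric] cmod_power2 by (simp add: power2_eq_square algebra_simps)
  also have "cmod (w - of_real t) = cmod (z - of_real t * cis \<gamma>)"
    unfolding zw left_diff_distrib[symmetric] by (simp add: norm_mult)
  finally have "sin \<eta> * cmod z \<le> cmod (z - of_real t * cis \<gamma>)"
    by (rule power2_le_imp_le) simp
  then show "cmod z \<le> 1 / sin \<eta> * cmod (z - of_real t * cis ((\<alpha> + \<beta>) / 2))"
    using s by (simp add: \<gamma>_def field_simps)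
qed

theorem theorem1:
  fixes K :: "complex set" and m :: nat and \<delta> \<alpha> \<beta> :: real
  assumes "compact K"
    and "0 \<in> frontier K"
    and "m > 0"
    and "\<delta> > 0"
    and "\<alpha> < \<beta>"
    and "sector \<delta> \<alpha> \<beta> \<inter> K = {0}"
  shows "\<forall>f \<in> hol_vanishing K. \<forall>\<epsilon>>0. \<exists>g \<in> hol_vanishing_order m K.
           (SUP x\<in>K. cmod (f x - g x)) < \<epsilon>"
proof (intro ballI allI impI)
  fix f and \<epsilon> :: real
  assume "f \<in> hol_vanishing K" "\<epsilon> > 0"
  then obtain F U where f: "f = restrict F K" and U: "open U" "K \<subseteq> U"
    and F: "F holomorphic_on U" "F 0 = 0"
    unfolding hol_vanishing_def by blast
  have "0 \<in> K" using assms(6) by blast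
  with U have "0 \<in> U" by blast
  define u where "u = cis ((\<alpha> + \<beta>) / 2)"
  have [simp]: "cmod u = 1" "u \<noteq> 0" by (simp_all add: u_def)
  obtain C where C: "C > 0" and
    C_bound: "\<And>z t. z \<notin> sector \<delta> \<alpha> \<beta> \<Longrightarrow> cmod z \<le> \<delta> \<Longrightarrow> 0 \<le> t \<Longrightarrow>
      cmod z \<le> C * cmod (z - of_real t * u)"
    using norm_le_dist_bisector[OF assms(5)] unfolding u_def by metis
  have cont: "continuous_on U F" by (rule holomorphic_on_imp_continuous_on[OF F(1)])
  then have "compact (F ` K)"
    using assms(1) U(2) by (metis compact_continuous_image continuous_on_subset)
  then obtain M where M: "M > 0" "\<And>z. z \<in> K \<Longrightarrow> cmod (F z) \<le> M"
    using bounded_pos[of "F ` K"] compact_imp_bounded by auto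
  \<comment> \<open>Near 0 the factor \<open>q z ^ m - 1\<close> is only bounded, by
    \<open>C ^ m + 1\<close>, so the smallness must come from \<open>F\<close>.\<close>
  have near0: "\<epsilon> / (2 * (C ^ m + 1)) > 0"
    using \<open>\<epsilon> > 0\<close> C by (simp add: add_pos_pos)
  have "isCont F 0" using cont U \<open>0 \<in> U\<close> continuous_on_eq_continuous_at by blast
  then obtain \<rho>0 where "\<rho>0 > 0"
    and \<rho>0: "\<And>z. cmod z < \<rho>0 \<Longrightarrow> cmod (F z) < \<epsilon> / (2 * (C ^ m + 1))"
    using near0 F(2) unfolding continuous_at_eps_delta by (metis dist_0_norm dist_commute)
  define \<rho> where "\<rho> = min \<rho>0 \<delta>"
  have \<rho>: "\<rho> > 0" "\<rho> \<le> \<rho>0" "\<rho> \<le> \<delta>" using \<open>\<rho>0 > 0\<close> assms(4) by (auto simp: \<rho>_def)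
  \<comment> \<open>Away from 0 the roles are exchanged: \<open>F\<close> is bounded by
    \<open>M\<close>, and \<open>q z ^ m - 1\<close> is made small by bringing \<open>q z\<close>
    within \<kappa> of 1.\<close>
  have "isCont (\<lambda>w::complex. w ^ m) 1" by simp
  moreover have "\<epsilon> / (2 * M) > 0" using \<open>\<epsilon> > 0\<close> M(1) by simp
  ultimately obtain \<kappa> where "\<kappa> > 0"
    and \<kappa>: "\<And>w::complex. cmod (w - 1) < \<kappa> \<Longrightarrow> cmod (w ^ m - 1) < \<epsilon> / (2 * M)"
    unfolding continuous_at_eps_delta dist_norm by (metis power_one)
  \<comment> \<open>The bound \<delta> keeps the pole \<open>p\<close> in the sector, hence off
    \<open>K\<close>. The second bound, with its factor 2, gives the strict inequality
    \<open>t * (1 + \<kappa>) < \<rho> * \<kappa>\<close>, which rearranges to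
    \<open>t_small\<close>.\<close>
  define t where "t = min \<delta> (\<rho> * \<kappa> / (2 * (1 + \<kappa>)))"
  have t: "t > 0" "t \<le> \<delta>" using assms(4) \<rho>(1) \<open>\<kappa> > 0\<close> by (auto simp: t_def)
  have t_small: "t < \<kappa> * (\<rho> - t)"
  proof -
    have "t \<le> \<rho> * \<kappa> / (2 * (1 + \<kappa>))" by (simp add: t_def)
    then have "2 * (t * (1 + \<kappa>)) \<le> \<rho> * \<kappa>" using \<open>\<kappa> > 0\<close> by (simp add: field_simps)
    moreover have "0 < \<rho> * \<kappa>" using \<rho>(1) \<open>\<kappa> > 0\<close> by simp
    ultimately show ?thesis by (simp add: algebra_simps)
  qed
  define p where "p = of_real t * u"
  have "p \<noteq> 0" and norm_p: "cmod p = t" using t by (simp_all add: p_def norm_mult)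
  have "p \<in> sector \<delta> \<alpha> \<beta>"
    unfolding sector_def p_def u_def cis_conv_exp using t assms(5)
    by (intro CollectI exI[of _ t] exI[of _ "(\<alpha> + \<beta>) / 2"]) auto
  then have "p \<notin> K" using assms(6) \<open>p \<noteq> 0\<close> by blast
  define q where "q z = z / (z - p)" for z
  define G where "G z = F z * q z ^ m" for z
  have "restrict G K \<in> hol_vanishing_order m K"
  proof -
    define V where "V = U - {p}"
    have V: "open V" "K \<subseteq> V" "0 \<in> V"
      using U \<open>p \<notin> K\<close> \<open>p \<noteq> 0\<close> \<open>0 \<in> U\<close> by (auto simp: V_def)
    have FV: "F holomorphic_on V" using F(1) by (rule holomorphic_on_subset) (auto simp: V_def)
    \<comment> \<open>The second function is the cofactor of \<open>z ^ m\<close> in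
      \<open>G\<close>; it vanishes at 0 because \<open>F\<close> does.\<close>
    have "G holomorphic_on V" "(\<lambda>z. F z / (z - p) ^ m) holomorphic_on V"
      unfolding G_def q_def by (intro holomorphic_intros FV; simp add: V_def)+
    moreover have "(deriv ^^ j) G 0 = 0" if "j \<le> m" for j
      by (rule higher_deriv_power_mult_eq_0[OF V(1,3) calculation(2) _ _ that])
         (simp_all add: F(2) G_def q_def power_divide)
    ultimately show ?thesis using V unfolding hol_vanishing_order_def by blast
  qed
  \<comment> \<open>Pointwise bounds only give a non-strict bound on the supremum, so half of
    \<epsilon> is aimed for.\<close>
  moreover have "(SUP x\<in>K. cmod (f x - restrict G K x)) \<le> \<epsilon> / 2"
  proof (rule cSUP_least)
    show "K \<noteq> {}" using \<open>0 \<in> K\<close> by blast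
    fix z assume "z \<in> K"
    have "cmod (f z - restrict G K z) = cmod (F z) * cmod (q z ^ m - 1)"
    proof -
      have "f z - restrict G K z = - (F z * (q z ^ m - 1))"
        using \<open>z \<in> K\<close> by (simp add: f G_def algebra_simps)
      then show ?thesis by (simp only: norm_minus_cancel norm_mult)
    qed
    also have "\<dots> \<le> \<epsilon> / 2"
    proof (cases "cmod z < \<rho>")
      case True
      have "cmod (q z) \<le> C"
      \<comment> \<open>The origin lies in the sector, so \<open>C_bound\<close> does not cover it;
        there \<open>q\<close> is 0.\<close>
      proof (cases "z = 0")
        case False
        then have "cmod z \<le> C * cmod (z - p)"
          using assms(6) \<open>z \<in> K\<close> True \<rho>(3) t(1) unfolding p_def by (intro C_bound) auto
        then show ?thesis
          using \<open>z \<in> K\<close> \<open>p \<notin> K\<close> by (auto simp: q_def norm_divide divide_simps)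
      qed (use C in \<open>simp add: q_def\<close>)
      then have "cmod (q z ^ m - 1) \<le> C ^ m + 1"
        using norm_triangle_ineq4[of "q z ^ m" 1] power_mono[of "cmod (q z)" C m]
        by (simp add: norm_power)
      moreover have "cmod (F z) \<le> \<epsilon> / (2 * (C ^ m + 1))"
        using \<rho>0[of z] True \<rho>(2) by simp
      ultimately have "cmod (F z) * cmod (q z ^ m - 1) \<le> \<epsilon> / (2 * (C ^ m + 1)) * (C ^ m + 1)"
        using near0 by (intro mult_mono) auto
      also have "\<dots> = \<epsilon> / 2"
        using C by (simp add: field_simps add_pos_pos less_imp_neq[symmetric])
      finally show ?thesis .
    next
      case False
      have "z \<noteq> p" using \<open>z \<in> K\<close> \<open>p \<notin> K\<close> by blast
      \<comment> \<open>This quotient has modulus \<open>t / cmod (z - p)\<close>, and its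
        denominator is at least \<open>\<rho> - t\<close> here, so \<open>t_small\<close> makes it
        less than \<kappa>.\<close>
      then have "q z - 1 = p / (z - p)" by (simp add: q_def field_simps)
      moreover have "t < \<kappa> * cmod (z - p)"
      proof -
        have "\<rho> - t \<le> cmod (z - p)"
          using False norm_p norm_triangle_ineq2[of z p] by simp
        then show ?thesis
          using t_small \<open>\<kappa> > 0\<close> by (meson less_le_trans mult_left_mono less_imp_le)
      qed
      ultimately have "cmod (q z - 1) < \<kappa>"
        using \<open>z \<noteq> p\<close> by (simp only: norm_divide norm_p) (simp add: divide_less_eq)
      then have "cmod (q z ^ m - 1) \<le> \<epsilon> / (2 * M)" using \<kappa> less_imp_le by blast
      then have "cmod (F z) * cmod (q z ^ m - 1) \<le> M * (\<epsilon> / (2 * M))"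
        using M \<open>z \<in> K\<close> by (intro mult_mono) auto
      then show ?thesis using M(1) by simp
    qed
    finally show "cmod (f z - restrict G K z) \<le> \<epsilon> / 2" .
  qed
  ultimately show "\<exists>g \<in> hol_vanishing_order m K. (SUP x\<in>K. cmod (f x - g x)) < \<epsilon>"
    using \<open>\<epsilon> > 0\<close> by (intro bexI[of _ "restrict G K"]) auto
qed

end
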